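(* Let $X$ be a real Banach lattice, let $E\subset X$ be a closed subspace, let $(e_n)_{n\in\mathbb{N}}$ be a semi-normalized absolutely quasi-greedy basis of $E$, and let $a>1$. The following are equivalent: (i) For all real sequences $(\lambda_n)$ with $1\leq|\lambda_n|\leq a$ for all $n$, the basis $(\lambda_n e_n)$ is absolutely quasi-greedy; (ii) For all $x\in E$, there exists $u\in X$ such that $$\forall k\in\mathbb{Z}:\quad\sum_{n\in A_k^a(x)}|e_n^*(x)e_n|\leq u;$$ (iii) For all $x\in E$, there exists $C>0$ such that $$\forall N\in\mathbb{N}:\quad\left\|\bigvee_{k=-N}^{N}\sum_{n\in A_k^a(x)}|e_n^*(x)e_n|\right\|\leq C.$$
   Context: All Banach spaces are over $\mathbb{R}$; $E$ carries the norm of $X$. "Basis" means Schauder basis; semi-normalized means $0<\inf_n\|e_n\|\le\sup_n\|e_n\|<\infty$; $e_n^*$ denotes the biorthogonal (coefficient) functionals and $\mathrm{supp}(x)=\{n: e_n^*(x)\ne 0\}$. A greedy ordering of $x\in E$ is an injective map $\pi:\mathbb{N}\to\mathbb{N}$ with $\mathrm{supp}(x)\subset\pi(\mathbb{N})$ such that $(|e^*_{\pi(n)}(x)|)_n$ is non-increasing. For such $\pi$ and $m\in\mathbb{N}$, $G_{\pi,m}(x)=\sum_{n=1}^m e^*_{\pi(n)}(x)e_{\pi(n)}$ and $G_{\pi,m}^{\vee}(x)=\bigvee_{n=1}^m|G_{\pi,n}(x)|$. The basis $(e_n)$ of $E\subset X$ is absolutely quasi-greedy if for every $x\in E$ there exists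 $u\in X$ such that $G_{\pi,m}^{\vee}(x)\leq u$ for all greedy orderings $\pi$ of $x$ and all $m\in\mathbb{N}$. For a scaled basis $(\lambda_n e_n)$ the same definitions are used with its own biorthogonal functionals $\lambda_n^{-1}e_n^*$. For $x\in E$ and $k\in\mathbb{Z}$, $A_k^a(x)=\{n\in\mathbb{N}: a^k<|e_n^*(x)|\leq a^{k+1}\}$, a finite set. *)

theory Defs
  imports "HOL-Analysis.Analysis" "HOL-Library.Lattice_Algebras"
begin

text \<open>The class \<^class>\<open>lattice_ab_group_add_abs\<close> provides \<open>\<bar>x\<bar> = sup x (- x)\<close>.\<close>

class banach_lattice = banach + ordered_real_vector + lattice_ab_group_add_abs +
  assumes norm_mono_abs: "\<bar>x\<bar> \<le> \<bar>y\<bar> \<Longrightarrow> norm x \<le> norm y"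

definition schauder_basis :: "'a::real_normed_vector set \<Rightarrow> (nat \<Rightarrow> 'a) \<Rightarrow> bool" where
  "schauder_basis E e \<longleftrightarrow>
     (\<forall>n. e n \<in> E) \<and> (\<forall>x\<in>E. \<exists>!c::nat \<Rightarrow> real. (\<lambda>n. c n *\<^sub>R e n) sums x)"

text \<open>The value of the \<open>n\<close>-th biorthogonal functional of the basis \<open>e\<close> at \<open>x\<close>; meaningful
  for \<open>x\<close> in the space spanned by the basis. The functionals are computed from \<open>e\<close> itself, so
  rescaling the basis rescales them (see \<open>basis_coeff_scale\<close> below).\<close>

definition basis_coeff :: "(nat \<Rightarrow> 'a::real_normed_vector) \<Rightarrow> nat \<Rightarrow> 'a \<Rightarrow> real" where
  "basis_coeff e n x = (THE c. (\<lambda>n. c n *\<^sub>R e n) sums x) n"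

definition basis_supp :: "(nat \<Rightarrow> 'a::real_normed_vector) \<Rightarrow> 'a \<Rightarrow> nat set" where
  "basis_supp e x = {n. basis_coeff e n x \<noteq> 0}"

definition semi_normalized :: "(nat \<Rightarrow> 'a::real_normed_vector) \<Rightarrow> bool" where
  "semi_normalized e \<longleftrightarrow> 0 < (INF n. norm (e n)) \<and> bdd_above (range (\<lambda>n. norm (e n)))"

definition greedy_ordering ::
    "(nat \<Rightarrow> 'a::real_normed_vector) \<Rightarrow> 'a \<Rightarrow> (nat \<Rightarrow> nat) \<Rightarrow> bool" where
  "greedy_ordering e x \<pi> \<longleftrightarrow>
     inj \<pi> \<and> basis_supp e x \<subseteq> range \<pi> \<and> decseq (\<lambda>n. \<bar>basis_coeff e (\<pi> n) x\<bar>)"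

text \<open>Sequences are indexed from 0, so the first \<open>m\<close> terms are those with index \<open>n < m\<close>.\<close>

definition greedy_sum ::
    "(nat \<Rightarrow> 'a::real_normed_vector) \<Rightarrow> (nat \<Rightarrow> nat) \<Rightarrow> nat \<Rightarrow> 'a \<Rightarrow> 'a" where
  "greedy_sum e \<pi> m x = (\<Sum>n<m. basis_coeff e (\<pi> n) x *\<^sub>R e (\<pi> n))"

text \<open>Only used for \<open>m \<ge> 1\<close>, where the supremum is over a nonempty finite set.\<close>

definition greedy_max ::
    "(nat \<Rightarrow> 'a::banach_lattice) \<Rightarrow> (nat \<Rightarrow> nat) \<Rightarrow> nat \<Rightarrow> 'a \<Rightarrow> 'a" where
  "greedy_max e \<pi> m x = Sup_fin ((\<lambda>n. \<bar>greedy_sum e \<pi> n x\<bar>) ` {1..m})"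

definition absolutely_quasi_greedy :: "'a::banach_lattice set \<Rightarrow> (nat \<Rightarrow> 'a) \<Rightarrow> bool" where
  "absolutely_quasi_greedy E e \<longleftrightarrow> schauder_basis E e \<and>
     (\<forall>x\<in>E. \<exists>u. \<forall>\<pi> m. greedy_ordering e x \<pi> \<longrightarrow> 1 \<le> m \<longrightarrow> greedy_max e \<pi> m x \<le> u)"

definition level_set ::
    "(nat \<Rightarrow> 'a::real_normed_vector) \<Rightarrow> real \<Rightarrow> int \<Rightarrow> 'a \<Rightarrow> nat set" where
  "level_set e a k x =
     {n. a powi k < \<bar>basis_coeff e n x\<bar> \<and> \<bar>basis_coeff e n x\<bar> \<le> a powi (k + 1)}"

lemma basis_coeff_sums:
  assumes "schauder_basis E e" "x \<in> E"
  shows "(\<lambda>n. basis_coeff e n x *\<^sub>R e n) sums x"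
proof -
  have "\<exists>!c. (\<lambda>n. c n *\<^sub>R e n) sums x"
    using assms by (simp add: schauder_basis_def)
  from theI'[OF this] show ?thesis
    by (simp add: basis_coeff_def)
qed

lemma basis_coeff_unique:
  assumes "schauder_basis E e" "x \<in> E" "(\<lambda>n. c n *\<^sub>R e n) sums x"
  shows "basis_coeff e n x = c n"
proof -
  have "\<exists>!c. (\<lambda>n. c n *\<^sub>R e n) sums x"
    using assms by (simp add: schauder_basis_def)
  from the1_equality[OF this, of c] assms(3) show ?thesis
    by (simp add: basis_coeff_def)
qed

lemma schauder_basis_scale:
  assumes E: "subspace E" and b: "schauder_basis E e" and nz: "\<And>n. l n \<noteq> 0"
  shows "schauder_basis E (\<lambda>n. l n *\<^sub>R e n)"
proof -
  have "\<exists>!c. (\<lambda>n. c n *\<^sub>R l n *\<^sub>R e n) sums x" if x: "x \<in> E" for x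
  proof
    show "(\<lambda>n. (basis_coeff e n x / l n) *\<^sub>R l n *\<^sub>R e n) sums x"
      using basis_coeff_sums[OF b x] nz by simp
  next
    fix c assume "(\<lambda>n. c n *\<^sub>R l n *\<^sub>R e n) sums x"
    then have "(\<lambda>n. (c n * l n) *\<^sub>R e n) sums x" by simp
    from basis_coeff_unique[OF b x this] show "c = (\<lambda>n. basis_coeff e n x / l n)"
      using nz by auto
  qed
  then show ?thesis
    using E b by (auto simp: schauder_basis_def subspace_scale)
qed

lemma basis_coeff_scale:
  assumes "subspace E" "schauder_basis E e" "\<And>n. l n \<noteq> 0" "x \<in> E"
  shows "basis_coeff (\<lambda>n. l n *\<^sub>R e n) n x = inverse (l n) * basis_coeff e n x"
  by (rule basis_coeff_unique[OF schauder_basis_scale[OF assms(1-3)] assms(4)])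
     (use basis_coeff_sums[OF assms(2,4)] assms(3) in \<open>simp add: field_simps\<close>)

text \<open>Hence the sums over level sets below are genuine finite sums.\<close>

lemma finite_level_set:
  assumes b: "schauder_basis E e" and s: "semi_normalized e" and x: "x \<in> E" and a: "1 < a"
  shows "finite (level_set e a k x)"
proof -
  define d where "d = (INF n. norm (e n))"
  have d: "0 < d" using s by (simp add: semi_normalized_def d_def)
  have dn: "d \<le> norm (e n)" for n
    unfolding d_def by (rule cINF_lower) (auto intro: bdd_belowI[of _ 0])
  have "(\<lambda>n. basis_coeff e n x *\<^sub>R e n) \<longlonglongrightarrow> 0"
    using basis_coeff_sums[OF b x] by (intro summable_LIMSEQ_zero) (rule sums_summable)
  moreover have "0 < a powi k * d" using a d by simp
  ultimately obtain N where
      N: "\<And>n. n \<ge> N \<Longrightarrow> norm (basis_coeff e n x *\<^sub>R e n) < a powi k * d"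
    unfolding LIMSEQ_iff diff_zero by blast
  have "n < N" if n: "n \<in> level_set e a k x" for n
  proof (rule ccontr)
    assume "\<not> n < N"
    then have "norm (basis_coeff e n x *\<^sub>R e n) < a powi k * d" using N by simp
    moreover have "a powi k * d \<le> \<bar>basis_coeff e n x\<bar> * norm (e n)"
      using n d dn[of n] by (intro mult_mono) (auto simp: level_set_def)
    ultimately show False by simp
  qed
  then show ?thesis by (meson finite_nat_set_iff_bounded)
qed

end

theory Submission
  imports Defs
begin

section \<open>Banach lattices\<close>

text \<open>Greedy orderings are replaced by greedy sets: finite index sets whose coefficients
  dominate in modulus all coefficients outside. These are exactly the initial segments of greedy
  orderings, so a basis is absolutely quasi-greedy iff, for each x, the partial sums of x over
  greedy sets are order bounded (\<open>absolutely_quasi_greedy_iff_greedy_sets\<close>). Rescaling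
  the basis keeps the terms of the expansion and changes only which sets are greedy.

  From (i) to (ii): choose scalars that flatten the coefficients of x to a single modulus on every
  level. Each subset of a level is then a difference of two greedy sets, so its sum is order
  bounded, and \<open>sum_abs_le_subsums\<close> passes from subset sums to sums of moduli. From
  (ii) to (i): since 1 <= |l n| <= a, a greedy set of the rescaled coefficients is, up to zero
  coefficients, a greedy set of the original ones together with part of two adjacent levels; the
  hypothesis on e bounds the former and (ii) the latter.

  From (ii) to (iii) the norm is monotone. The converse is a gliding hump argument
  (\<open>level_sums_small_on_tails\<close>): were the suprema of level sums far out in the
  expansion not small, weights a^j on successive segments would produce a z in E violating (iii).
  Hence the finite suprema form a Cauchy sequence, and its limit is an upper bound because the order
  is closed.\<close>

lemma norm_mono_nonneg:
  fixes x y :: "'a::banach_lattice"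
  assumes "0 \<le> x" "x \<le> y"
  shows "norm x \<le> norm y"
  using assms by (intro norm_mono_abs) (simp add: order_trans[OF assms])

text \<open>The order is closed: the positive part of \<open>w - u\<close> is eventually dominated
  by \<open>\<bar>U n - u\<bar>\<close>, whose norm tends to 0.\<close>

lemma le_of_tendsto_eventually:
  fixes u w :: "'a::banach_lattice"
  assumes lim: "U \<longlonglongrightarrow> u" and le: "eventually (\<lambda>n. w \<le> U n) sequentially"
  shows "w \<le> u"
proof -
  let ?p = "sup (w - u) 0"
  have "norm ?p \<le> norm (U n - u)" if "w \<le> U n" for n
  proof (rule norm_mono_abs)
    have "w - u \<le> \<bar>U n - u\<bar>"
      using that abs_ge_self[of "U n - u"] by (meson diff_right_mono order_trans)
    then have "?p \<le> \<bar>U n - u\<bar>" by simp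
    then show "\<bar>?p\<bar> \<le> \<bar>U n - u\<bar>" by (simp add: abs_of_nonneg)
  qed
  with le have "eventually (\<lambda>n. norm ?p \<le> norm (U n - u)) sequentially"
    by (auto elim: eventually_mono)
  moreover have "(\<lambda>n. norm (U n - u)) \<longlonglongrightarrow> 0"
    using lim by (simp add: LIM_zero tendsto_norm_zero)
  ultimately have "norm ?p \<le> 0"
    by (intro tendsto_lowerbound[of "\<lambda>n. norm (U n - u)" 0 sequentially]) auto
  then have "?p = 0" by simp
  then have "w - u \<le> 0" by (metis sup.cobounded1)
  then show ?thesis by simp
qed

lemma abs_scaleR_pos_ge:
  fixes v :: "'a::banach_lattice"
  assumes "0 < c"
  shows "c *\<^sub>R \<bar>v\<bar> \<le> \<bar>c *\<^sub>R v\<bar>"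
proof -
  have "w \<le> (1 / c) *\<^sub>R \<bar>c *\<^sub>R v\<bar>" if "c *\<^sub>R w \<le> \<bar>c *\<^sub>R v\<bar>" for w
    using scaleR_left_mono[OF that, of "1 / c"] assms by simp
  then have "\<bar>v\<bar> \<le> (1 / c) *\<^sub>R \<bar>c *\<^sub>R v\<bar>"
    by (intro abs_leI) (auto simp: abs_ge_self abs_ge_minus_self)
  then show ?thesis
    using scaleR_left_mono[of "\<bar>v\<bar>" _ c] assms by fastforce
qed

lemma abs_add_le:
  fixes x y :: "'a::lattice_ab_group_add_abs"
  assumes "\<bar>x\<bar> \<le> v" "\<bar>y\<bar> \<le> w"
  shows "\<bar>x + y\<bar> \<le> v + w"
  using abs_triangle_ineq[of x y] add_mono[OF assms] by (rule order_trans)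

lemma abs_diff_le:
  fixes x y :: "'a::lattice_ab_group_add_abs"
  assumes "\<bar>x\<bar> \<le> v" "\<bar>y\<bar> \<le> w"
  shows "\<bar>x - y\<bar> \<le> v + w"
  using abs_triangle_ineq4[of x y] add_mono[OF assms] by (rule order_trans)

text \<open>A sum of moduli is the least upper bound of all sums with signs; B collects the indices
  with sign plus. The induction moves \<open>\<bar>y i\<bar>\<close> of the new index into the
  bound, hence the arbitrary w.\<close>

lemma sum_abs_le_signs:
  fixes y :: "'b \<Rightarrow> 'a::lattice_ab_group_add_abs"
  assumes "finite A" "\<And>B. B \<subseteq> A \<Longrightarrow> sum y B - sum y (A - B) \<le> w"
  shows "(\<Sum>n\<in>A. \<bar>y n\<bar>) \<le> w"
  using assms
proof (induction A arbitrary: w rule: finite_induct)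
  case empty
  then show ?case by simp
next
  case (insert i A)
  have "sum y B - sum y (A - B) \<le> w - \<bar>y i\<bar>" if B: "B \<subseteq> A" for B
  proof -
    have fB: "finite B" "i \<notin> B" using B insert.hyps finite_subset by auto
    have "insert i A - insert i B = A - B" "insert i A - B = insert i (A - B)"
      using insert.hyps(2) fB(2) by auto
    then have "y i + sum y B - sum y (A - B) \<le> w" "sum y B - (y i + sum y (A - B)) \<le> w"
      using insert.prems[of "insert i B"] insert.prems[of B] B fB insert.hyps by auto
    then have "\<bar>y i\<bar> \<le> w - (sum y B - sum y (A - B))"
      by (intro abs_leI) (simp_all add: algebra_simps)
    then show ?thesis by (simp add: algebra_simps)
  qed
  from insert.IH[OF this] show ?case
    using insert.hyps by (simp add: algebra_simps)
qed

lemma sum_abs_le_subsums: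
  fixes y :: "'b \<Rightarrow> 'a::lattice_ab_group_add_abs"
  assumes "finite A" "\<And>B. B \<subseteq> A \<Longrightarrow> \<bar>sum y B\<bar> \<le> v"
  shows "(\<Sum>n\<in>A. \<bar>y n\<bar>) \<le> v + v"
proof (rule sum_abs_le_signs[OF assms(1)])
  fix B assume "B \<subseteq> A"
  then have "\<bar>sum y B - sum y (A - B)\<bar> \<le> v + v"
    by (intro abs_diff_le assms(2)) auto
  with abs_ge_self show "sum y B - sum y (A - B) \<le> v + v"
    by (rule order_trans)
qed

section \<open>Greedy sets\<close>

text \<open>Ties between members and non-members are allowed, so a block of equal moduli can be
  split arbitrarily.\<close>

definition greedy_set :: "(nat \<Rightarrow> real) \<Rightarrow> nat set \<Rightarrow> bool" where
  "greedy_set c S \<longleftrightarrow> finite S \<and> (\<forall>i\<in>S. \<forall>j. j \<notin> S \<longrightarrow> \<bar>c j\<bar> \<le> \<bar>c i\<bar>)"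

lemma finite_large_terms:
  fixes c :: "nat \<Rightarrow> real"
  assumes "c \<longlonglongrightarrow> 0" "0 < t"
  shows "finite {n. t \<le> \<bar>c n\<bar>}"
proof -
  obtain N where N: "\<And>n. n \<ge> N \<Longrightarrow> \<bar>c n\<bar> < t"
    using assms unfolding LIMSEQ_iff by fastforce
  have "{n. t \<le> \<bar>c n\<bar>} \<subseteq> {..<N}"
  proof
    fix n assume "n \<in> {n. t \<le> \<bar>c n\<bar>}"
    then show "n \<in> {..<N}" using N[of n] by (cases "n < N") auto
  qed
  then show ?thesis using finite_subset by blast
qed

lemma exists_bound_on_finite:
  fixes f :: "'b \<Rightarrow> nat"
  assumes "finite A"
  shows "\<exists>M. \<forall>i\<in>A. f i < M"
  using assms finite_nat_set_iff_bounded[of "f ` A"] by simp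

lemma exists_maximal_element:
  fixes f :: "'b \<Rightarrow> 'c::linorder"
  assumes "finite A" "A \<noteq> {}"
  obtains j where "j \<in> A" "\<And>i. i \<in> A \<Longrightarrow> f i \<le> f j"
proof -
  obtain j where j: "j \<in> A" "Max (f ` A) = f j" using obtains_MAX[OF assms] .
  have "f i \<le> f j" if "i \<in> A" for i
    unfolding j(2)[symmetric] using assms(1) that by (intro Max_ge) auto
  with j(1) show ?thesis by (rule that)
qed

lemma exists_max_outside_finite:
  fixes c :: "nat \<Rightarrow> real"
  assumes c: "c \<longlonglongrightarrow> 0" and T: "finite T"
  shows "\<exists>j. j \<notin> T \<and> (\<forall>i. i \<notin> T \<longrightarrow> \<bar>c i\<bar> \<le> \<bar>c j\<bar>)"
proof (cases "\<exists>j. j \<notin> T \<and> c j \<noteq> 0")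
  case True
  then obtain j0 where j0: "j0 \<notin> T" "c j0 \<noteq> 0" by blast
  let ?A = "{n. \<bar>c j0\<bar> \<le> \<bar>c n\<bar>} - T"
  have "finite ?A" using finite_large_terms[OF c, of "\<bar>c j0\<bar>"] j0 by simp
  moreover have "?A \<noteq> {}" using j0 by auto
  ultimately obtain j where j: "j \<in> ?A" "\<And>i. i \<in> ?A \<Longrightarrow> \<bar>c i\<bar> \<le> \<bar>c j\<bar>"
    using exists_maximal_element[of ?A "\<lambda>n. \<bar>c n\<bar>"] by blast
  have "\<bar>c i\<bar> \<le> \<bar>c j\<bar>" if "i \<notin> T" for i
    using j that by (cases "\<bar>c j0\<bar> \<le> \<bar>c i\<bar>") auto
  then show ?thesis using j by auto
next
  case False
  obtain j where "j \<notin> T" using T ex_new_if_finite infinite_UNIV_nat by blast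
  then show ?thesis using False by (intro exI[of _ j]) auto
qed

text \<open>Always pick a remaining index of largest modulus, breaking ties in favour of S; since S
  is greedy, it is exhausted first.\<close>

lemma greedy_ordering_extending_set:
  fixes c :: "nat \<Rightarrow> real"
  assumes c: "c \<longlonglongrightarrow> 0" and S: "greedy_set c S"
  obtains \<pi> :: "nat \<Rightarrow> nat" where "inj \<pi>" "{n. c n \<noteq> 0} \<subseteq> range \<pi>"
    "decseq (\<lambda>n. \<bar>c (\<pi> n)\<bar>)" "\<pi> ` {..<card S} = S"
proof -
  define good where "good T j \<longleftrightarrow> j \<notin> T \<and> (\<forall>i. i \<notin> T \<longrightarrow> \<bar>c i\<bar> \<le> \<bar>c j\<bar>) \<and> (S \<subseteq> T \<or> j \<in> S)"
    for T j
  have fS: "finite S" using S by (simp add: greedy_set_def)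
  have ex: "\<exists>j. good T j" if T: "finite T" for T
  proof (cases "S \<subseteq> T")
    case True
    then show ?thesis using exists_max_outside_finite[OF c T] by (auto simp: good_def)
  next
    case False
    then have "finite (S - T)" "S - T \<noteq> {}" using fS by auto
    then obtain j where j: "j \<in> S - T" "\<And>i. i \<in> S - T \<Longrightarrow> \<bar>c i\<bar> \<le> \<bar>c j\<bar>"
      using exists_maximal_element[of "S - T" "\<lambda>n. \<bar>c n\<bar>"] by blast
    have "\<bar>c i\<bar> \<le> \<bar>c j\<bar>" if "i \<notin> T" for i
      using j that S by (cases "i \<in> S") (auto simp: greedy_set_def)
    then show ?thesis using j by (auto simp: good_def)
  qed
  \<comment> \<open>Course-of-values recursion: each choice depends on the set of indices already
    taken.\<close>
  define \<pi> where "\<pi> = wfrec {(i, j::nat). i < j} (\<lambda>f n. SOME j. good (f ` {..<n}) j)"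
  have rec: "\<pi> n = (SOME j. good (\<pi> ` {..<n}) j)" for n
  proof -
    have "cut \<pi> {(i, j). i < j} n ` {..<n} = \<pi> ` {..<n}"
      by (auto simp: cut_def image_iff)
    then show ?thesis
      unfolding \<pi>_def by (subst wfrec[OF wf]) simp
  qed
  have good: "good (\<pi> ` {..<n}) (\<pi> n)" for n
    unfolding rec[of n] by (rule someI_ex) (rule ex, simp)
  have new: "\<pi> n \<noteq> \<pi> m" if "m < n" for m n
    using good[of n] that unfolding good_def by (metis imageI lessThan_iff)
  have inj: "inj \<pi>"
    by (rule injI) (metis new nat_neq_iff)
  have dec: "\<bar>c (\<pi> n)\<bar> \<le> \<bar>c (\<pi> m)\<bar>" if "m \<le> n" for m n
  proof -
    have "\<pi> n \<notin> \<pi> ` {..<m}" using that inj by (auto simp: inj_eq)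
    then show ?thesis using good[of m] by (simp add: good_def)
  qed
  \<comment> \<open>An index never chosen is dominated by infinitely many chosen ones, which a null
    sequence forbids unless its coefficient is 0.\<close>
  have supp: "n \<in> range \<pi>" if n: "c n \<noteq> 0" for n
  proof (rule ccontr)
    assume nr: "n \<notin> range \<pi>"
    then have "\<bar>c n\<bar> \<le> \<bar>c (\<pi> m)\<bar>" for m
      using good[of m] by (auto simp: good_def image_iff)
    then have "range \<pi> \<subseteq> {m. \<bar>c n\<bar> \<le> \<bar>c m\<bar>}" by auto
    then have "finite (range \<pi>)"
      using finite_large_terms[OF c, of "\<bar>c n\<bar>"] n finite_subset by auto
    then show False using inj range_inj_infinite by blast
  qed
  have "\<pi> ` {..<m} \<subseteq> S" if "m \<le> card S" for m
    using that
  proof (induction m)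
    case (Suc m)
    have "card (\<pi> ` {..<m}) = m" using inj by (simp add: card_image inj_on_subset)
    then have "\<not> S \<subseteq> \<pi> ` {..<m}"
      using Suc.prems card_mono[of "\<pi> ` {..<m}" S] by auto
    then have "\<pi> m \<in> S" using good[of m] by (simp add: good_def)
    then show ?case using Suc by (auto simp: lessThan_Suc)
  qed simp
  moreover have "card (\<pi> ` {..<card S}) = card S"
    using inj by (simp add: card_image inj_on_subset)
  ultimately have "\<pi> ` {..<card S} = S"
    using fS by (simp add: card_subset_eq)
  then show ?thesis
    using that[of \<pi>] inj supp dec by (auto simp: antimono_def)
qed

text \<open>An index outside the segment either has coefficient 0 or occurs later in the
  ordering.\<close>

lemma greedy_set_initial_segment:
  assumes \<pi>: "greedy_ordering e x \<pi>"
  shows "greedy_set (\<lambda>n. basis_coeff e n x) (\<pi> ` {..<m})"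
proof -
  let ?c = "\<lambda>n. basis_coeff e n x"
  have "\<bar>?c j\<bar> \<le> \<bar>?c (\<pi> p)\<bar>" if p: "p < m" and j: "j \<notin> \<pi> ` {..<m}" for p j
  proof (cases "?c j = 0")
    case False
    then obtain q where q: "j = \<pi> q"
      using \<pi> by (auto simp: greedy_ordering_def basis_supp_def)
    with j have "p \<le> q" using p by (cases "q < m") auto
    then show ?thesis using \<pi> q by (auto simp: greedy_ordering_def decseq_def)
  qed simp
  then show ?thesis by (auto simp: greedy_set_def)
qed

lemma absolutely_quasi_greedy_iff_greedy_sets:
  fixes e :: "nat \<Rightarrow> 'a::banach_lattice"
  assumes b: "schauder_basis E e"
    and null: "\<And>x. x \<in> E \<Longrightarrow> (\<lambda>n. basis_coeff e n x) \<longlonglongrightarrow> 0"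
  shows "absolutely_quasi_greedy E e \<longleftrightarrow>
    (\<forall>x\<in>E. \<exists>u. \<forall>S. greedy_set (\<lambda>n. basis_coeff e n x) S \<longrightarrow>
       \<bar>\<Sum>n\<in>S. basis_coeff e n x *\<^sub>R e n\<bar> \<le> u)"
proof -
  have "(\<exists>u. \<forall>\<pi> m. greedy_ordering e x \<pi> \<longrightarrow> 1 \<le> m \<longrightarrow> greedy_max e \<pi> m x \<le> u) \<longleftrightarrow>
      (\<exists>u. \<forall>S. greedy_set (\<lambda>n. basis_coeff e n x) S \<longrightarrow>
         \<bar>\<Sum>n\<in>S. basis_coeff e n x *\<^sub>R e n\<bar> \<le> u)" (is "?L \<longleftrightarrow> ?R") if x: "x \<in> E" for x
  proof -
    have sum_eq: "greedy_sum e \<pi> m x = (\<Sum>n\<in>\<pi> ` {..<m}. basis_coeff e n x *\<^sub>R e n)"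
      if "inj \<pi>" for \<pi> m
      using that by (simp add: greedy_sum_def sum.reindex inj_on_subset)
    show ?thesis
    proof
      assume ?L
      then obtain u where u: "\<And>\<pi> m. greedy_ordering e x \<pi> \<Longrightarrow> 1 \<le> m \<Longrightarrow> greedy_max e \<pi> m x \<le> u"
        by blast
      have le: "\<bar>\<Sum>n\<in>S. basis_coeff e n x *\<^sub>R e n\<bar> \<le> u"
        if S: "greedy_set (\<lambda>n. basis_coeff e n x) S" and ne: "S \<noteq> {}" for S
      proof -
        obtain \<pi> where \<pi>: "greedy_ordering e x \<pi>" "inj \<pi>" "\<pi> ` {..<card S} = S"
          using greedy_ordering_extending_set[OF null[OF x] S]
          by (metis greedy_ordering_def basis_supp_def)
        have pos: "1 \<le> card S"
          using S ne by (simp add: greedy_set_def Suc_le_eq card_gt_0_iff)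
        then have "\<bar>greedy_sum e \<pi> (card S) x\<bar> \<le> greedy_max e \<pi> (card S) x"
          unfolding greedy_max_def by (intro Sup_fin.coboundedI) auto
        also have "\<dots> \<le> u" using u \<pi> pos by blast
        finally show ?thesis using \<pi> by (simp add: sum_eq)
      qed
      \<comment> \<open>\<open>greedy_max\<close> starts with one term, so the empty set needs
        \<open>0 \<le> u\<close>; a singleton greedy set provides it.\<close>
      obtain i where "greedy_set (\<lambda>n. basis_coeff e n x) {i}"
        using exists_max_outside_finite[OF null[OF x], of "{}"] by (auto simp: greedy_set_def)
      from le[OF this] have "0 \<le> u" using abs_ge_zero order_trans by blast
      with le show ?R by (metis abs_zero sum.empty)
    next
      assume ?R
      then obtain u where u: "\<And>S. greedy_set (\<lambda>n. basis_coeff e n x) S \<Longrightarrow>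
         \<bar>\<Sum>n\<in>S. basis_coeff e n x *\<^sub>R e n\<bar> \<le> u" by blast
      have "greedy_max e \<pi> m x \<le> u" if \<pi>: "greedy_ordering e x \<pi>" and m: "1 \<le> m" for \<pi> m
        unfolding greedy_max_def
      proof (rule Sup_fin.boundedI)
        fix v assume "v \<in> (\<lambda>n. \<bar>greedy_sum e \<pi> n x\<bar>) ` {1..m}"
        moreover have "inj \<pi>" using \<pi> by (simp add: greedy_ordering_def)
        ultimately show "v \<le> u"
          using u[OF greedy_set_initial_segment[OF \<pi>]] by (auto simp: sum_eq)
      qed (use m in auto)
      then show ?L by blast
    qed
  qed
  then show ?thesis using b by (simp add: absolutely_quasi_greedy_def)
qed

section \<open>Decay of coefficients and the geometric scale of levels\<close>

lemma basis_coeff_tendsto_0: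
  assumes b: "schauder_basis E e" and s: "semi_normalized e" and x: "x \<in> E"
  shows "(\<lambda>n. basis_coeff e n x) \<longlonglongrightarrow> 0"
proof -
  define d where "d = (INF n. norm (e n))"
  have d: "0 < d" using s by (simp add: semi_normalized_def d_def)
  have dn: "d \<le> norm (e n)" for n
    unfolding d_def by (rule cINF_lower) (auto intro: bdd_belowI[of _ 0])
  have "(\<lambda>n. basis_coeff e n x *\<^sub>R e n) \<longlonglongrightarrow> 0"
    using basis_coeff_sums[OF b x] by (intro summable_LIMSEQ_zero) (rule sums_summable)
  then have lim: "(\<lambda>n. norm (basis_coeff e n x *\<^sub>R e n) / d) \<longlonglongrightarrow> 0"
    using d by (intro tendsto_divide_zero tendsto_norm_zero)
  have "norm (basis_coeff e n x) \<le> norm (basis_coeff e n x *\<^sub>R e n) / d" for n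
    using d mult_left_mono[OF dn[of n], of "\<bar>basis_coeff e n x\<bar>"] by (simp add: field_simps)
  then show ?thesis
    by (intro Lim_null_comparison[OF _ lim]) simp
qed

lemma exists_power_int_bracket:
  fixes a t :: real
  assumes a: "1 < a" and t: "0 < t"
  obtains k :: int where "a powi k < t" "t \<le> a powi (k + 1)"
proof
  \<comment> \<open>The ceiling matches the half-open levels: an exact power of a is the right end
    point of its interval.\<close>
  let ?k = "\<lceil>log a t\<rceil> - 1"
  have eq: "a powi k = a powr of_int k" for k using a by (simp add: powr_real_of_int')
  have "of_int ?k < log a t" "log a t \<le> of_int (?k + 1)" by linarith+
  then show "a powi ?k < t" "t \<le> a powi (?k + 1)"
    unfolding eq less_log_iff[OF a t] log_le_iff[OF a t] by blast+
qed

lemma power_int_less_iff: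
  fixes a :: real
  assumes "1 < a"
  shows "a powi i < a powi j \<longleftrightarrow> i < j"
  using assms power_int_strict_increasing[of i j a] power_int_increasing[of j i a]
  by (meson less_imp_le not_less)

section \<open>Level sets and rescaled bases\<close>

text \<open>The factors cancel in each term, so the sums are those of the original expansion and the
  scalars enter only through greediness. As \<open>1 \<le> \<bar>l n\<bar>\<close>, the rescaled
  coefficients still tend to 0.\<close>

lemma scaled_basis_absolutely_quasi_greedy_iff:
  fixes e :: "nat \<Rightarrow> 'a::banach_lattice"
  assumes E: "subspace E" and b: "schauder_basis E e" and s: "semi_normalized e"
    and l: "\<And>n. 1 \<le> \<bar>l n\<bar>"
  shows "absolutely_quasi_greedy E (\<lambda>n. l n *\<^sub>R e n) \<longleftrightarrow>
    (\<forall>x\<in>E. \<exists>u. \<forall>S. greedy_set (\<lambda>n. basis_coeff e n x / l n) S \<longrightarrow>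
       \<bar>\<Sum>n\<in>S. basis_coeff e n x *\<^sub>R e n\<bar> \<le> u)"
proof -
  have nz: "l n \<noteq> 0" for n using l[of n] by auto
  have coeff: "basis_coeff (\<lambda>n. l n *\<^sub>R e n) n x = basis_coeff e n x / l n" if "x \<in> E" for x n
    using basis_coeff_scale[OF E b nz that] by (simp add: divide_inverse mult.commute)
  have null: "(\<lambda>n. basis_coeff (\<lambda>n. l n *\<^sub>R e n) n x) \<longlonglongrightarrow> 0" if x: "x \<in> E" for x
  proof (rule Lim_null_comparison)
    show "(\<lambda>n. \<bar>basis_coeff e n x\<bar>) \<longlonglongrightarrow> 0"
      using basis_coeff_tendsto_0[OF b s x] by (simp add: tendsto_rabs_zero)
    have "\<bar>basis_coeff e n x\<bar> / \<bar>l n\<bar> \<le> \<bar>basis_coeff e n x\<bar>" for n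
      using l[of n] by (simp add: divide_le_eq mult_le_cancel_left1)
    then show "\<forall>\<^sub>F n in sequentially.
        norm (basis_coeff (\<lambda>n. l n *\<^sub>R e n) n x) \<le> \<bar>basis_coeff e n x\<bar>"
      using coeff[OF x] by (simp add: abs_divide)
  qed
  show ?thesis
    using absolutely_quasi_greedy_iff_greedy_sets[OF schauder_basis_scale[OF E b nz]] null
    by (simp add: coeff nz cong: ball_cong)
qed

text \<open>The scalars are chosen such that the rescaled coefficients have constant modulus on each
  level set, so that every subset of a level set becomes a difference of two greedy sets.\<close>

lemma level_sums_bounded_if_scaled_absolutely_quasi_greedy:
  fixes e :: "nat \<Rightarrow> 'a::banach_lattice"
  assumes E: "subspace E" and b: "schauder_basis E e" and s: "semi_normalized e" and a: "1 < a"
    and scaled: "\<And>l. (\<And>n. 1 \<le> \<bar>l n\<bar> \<and> \<bar>l n\<bar> \<le> a) \<Longrightarrow>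
          absolutely_quasi_greedy E (\<lambda>n. l n *\<^sub>R e n)"
    and x: "x \<in> E"
  shows "\<exists>u. \<forall>k. (\<Sum>n\<in>level_set e a k x. \<bar>basis_coeff e n x *\<^sub>R e n\<bar>) \<le> u"
proof -
  let ?c = "\<lambda>n. basis_coeff e n x"
  let ?y = "\<lambda>n. ?c n *\<^sub>R e n"
  have "\<exists>k. ?c n \<noteq> 0 \<longrightarrow> a powi k < \<bar>?c n\<bar> \<and> \<bar>?c n\<bar> \<le> a powi (k + 1)" for n
    using exists_power_int_bracket[OF a, of "\<bar>?c n\<bar>"] by (metis zero_less_abs_iff)
  then obtain \<kappa> where
    \<kappa>: "\<And>n. ?c n \<noteq> 0 \<Longrightarrow> a powi \<kappa> n < \<bar>?c n\<bar> \<and> \<bar>?c n\<bar> \<le> a powi (\<kappa> n + 1)"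
    by metis
  define l where "l n = (if ?c n = 0 then 1 else \<bar>?c n\<bar> / a powi \<kappa> n)" for n
  have l: "1 \<le> \<bar>l n\<bar> \<and> \<bar>l n\<bar> \<le> a" for n
    using \<kappa>[of n] a by (auto simp: l_def field_simps power_int_add)
  have yl: "\<bar>?c n / l n\<bar> = (if ?c n = 0 then 0 else a powi \<kappa> n)" for n
    using a by (simp add: l_def abs_divide)
  obtain u where u: "\<And>S. greedy_set (\<lambda>n. ?c n / l n) S \<Longrightarrow> \<bar>sum ?y S\<bar> \<le> u"
    using scaled_basis_absolutely_quasi_greedy_iff[OF E b s, of l] l scaled[of l] x by blast
  have pw: "a powi i < a powi j \<longleftrightarrow> i < j" "a powi i \<le> a powi j \<longleftrightarrow> i \<le> j" for i j :: int
    using power_int_less_iff[OF a, of i j] power_int_less_iff[OF a, of j i] by linarith+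
  \<comment> \<open>One factor 2 comes from a difference of two greedy sets, the other from passing
    to moduli.\<close>
  have "(\<Sum>n\<in>level_set e a k x. \<bar>?y n\<bar>) \<le> (u + u) + (u + u)" for k
  proof (rule sum_abs_le_subsums)
    show fin: "finite (level_set e a k x)" by (rule finite_level_set[OF b s x a])
    \<comment> \<open>All levels above k. After rescaling, every index of level k has modulus
      \<open>a powi k\<close>, so both T and T with any part B of level k are greedy.\<close>
    define T where "T = {n. ?c n \<noteq> 0 \<and> k < \<kappa> n}"
    have "T \<subseteq> {n. a powi k \<le> \<bar>?c n\<bar>}"
    proof
      fix n assume n: "n \<in> T"
      then have "a powi k < a powi \<kappa> n" by (simp add: T_def pw)
      with n \<kappa>[of n] show "n \<in> {n. a powi k \<le> \<bar>?c n\<bar>}" by (simp add: T_def)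
    qed
    then have fT: "finite T"
      using finite_large_terms[OF basis_coeff_tendsto_0[OF b s x], of "a powi k"] a
      by (simp add: finite_subset)
    fix B assume B: "B \<subseteq> level_set e a k x"
    have Bk: "?c n \<noteq> 0" "\<kappa> n = k" if "n \<in> B" for n
    proof -
      have n: "a powi k < \<bar>?c n\<bar>" "\<bar>?c n\<bar> \<le> a powi (k + 1)"
        using that B by (auto simp: level_set_def)
      have "0 < a powi k" using a by simp
      with n show "?c n \<noteq> 0" by auto
      then have "a powi k < a powi (\<kappa> n + 1)" "a powi \<kappa> n < a powi (k + 1)"
        using n \<kappa>[of n] by linarith+
      then show "\<kappa> n = k" by (simp add: pw)
    qed
    have fB: "finite B" using B fin finite_subset by blast
    have "T \<inter> B = {}" using Bk by (auto simp: T_def)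
    then have "sum ?y B = sum ?y (T \<union> B) - sum ?y T"
      using fT fB by (simp add: sum.union_disjoint)
    moreover have "greedy_set (\<lambda>n. ?c n / l n) (T \<union> B)" "greedy_set (\<lambda>n. ?c n / l n) T"
      unfolding greedy_set_def yl using fT fB a Bk by (auto simp: T_def pw not_less)
    then have "\<bar>sum ?y (T \<union> B) - sum ?y T\<bar> \<le> u + u"
      by (intro abs_diff_le u)
    ultimately show "\<bar>sum ?y B\<bar> \<le> u + u" by simp
  qed
  then show ?thesis by blast
qed

text \<open>A greedy set of the rescaled coefficients lies between the greedy sets of the original
  coefficients at two thresholds that are two level sets apart.\<close>

lemma scaled_absolutely_quasi_greedy_if_level_sums_bounded:
  fixes e :: "nat \<Rightarrow> 'a::banach_lattice"
  assumes E: "subspace E" and b: "schauder_basis E e" and s: "semi_normalized e" and a: "1 < a"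
    and aqg: "absolutely_quasi_greedy E e"
    and bdd: "\<And>x. x \<in> E \<Longrightarrow>
      \<exists>u. \<forall>k. (\<Sum>n\<in>level_set e a k x. \<bar>basis_coeff e n x *\<^sub>R e n\<bar>) \<le> u"
    and l: "\<And>n. 1 \<le> \<bar>l n\<bar> \<and> \<bar>l n\<bar> \<le> a"
  shows "absolutely_quasi_greedy E (\<lambda>n. l n *\<^sub>R e n)"
  unfolding scaled_basis_absolutely_quasi_greedy_iff[OF E b s conjunct1[OF l]]
proof
  fix x assume x: "x \<in> E"
  let ?c = "\<lambda>n. basis_coeff e n x"
  let ?y = "\<lambda>n. ?c n *\<^sub>R e n"
  have null: "?c \<longlonglongrightarrow> 0" by (rule basis_coeff_tendsto_0[OF b s x])
  obtain v where v: "\<And>S. greedy_set ?c S \<Longrightarrow> \<bar>sum ?y S\<bar> \<le> v"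
    using aqg x absolutely_quasi_greedy_iff_greedy_sets[OF b basis_coeff_tendsto_0[OF b s]]
    by blast
  obtain w where w: "\<And>k. (\<Sum>n\<in>level_set e a k x. \<bar>?y n\<bar>) \<le> w"
    using bdd[OF x] by blast
  have w0: "0 \<le> w" using w[of 0] by (meson abs_ge_zero order_trans sum_nonneg)
  have "\<bar>sum ?y S\<bar> \<le> v + (w + w)" if S: "greedy_set (\<lambda>n. ?c n / l n) S" for S
  proof -
    have fS: "finite S" using S by (simp add: greedy_set_def)
    have "\<exists>T\<subseteq>S. greedy_set ?c T \<and> (\<exists>k. \<forall>n\<in>S - T. ?c n \<noteq> 0 \<longrightarrow>
        n \<in> level_set e a k x \<union> level_set e a (k + 1) x)"
    proof (cases "S = {} \<or> (\<exists>i\<in>S. ?c i = 0)")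
      case True
      \<comment> \<open>If a coefficient in S vanishes, greediness forces all coefficients outside S
        to vanish; the nonzero part of S is then greedy for the original coefficients.\<close>
      have zero: "?c j = 0" if "S \<noteq> {}" "j \<notin> S" for j
      proof -
        obtain i where "i \<in> S" "?c i = 0" using True \<open>S \<noteq> {}\<close> by blast
        then have "\<bar>?c j / l j\<bar> \<le> 0"
          using S that unfolding greedy_set_def by fastforce
        then show ?thesis using l[of j] by auto
      qed
      have "greedy_set ?c {n\<in>S. ?c n \<noteq> 0}"
        unfolding greedy_set_def
      proof (intro conjI ballI allI impI)
        fix i j assume "i \<in> {n\<in>S. ?c n \<noteq> 0}" "j \<notin> {n\<in>S. ?c n \<noteq> 0}"
        then have "?c j = 0" using zero[of j] by blast
        then show "\<bar>?c j\<bar> \<le> \<bar>?c i\<bar>" by simp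
      qed (use fS in simp)
      then show ?thesis by (intro exI[of _ "{n\<in>S. ?c n \<noteq> 0}"]) auto
    next
      case False
      \<comment> \<open>The threshold of S. Rescaling shrinks moduli by a factor of at most a, so
        \<open>\<bar>?c n\<bar>\<close> is at least t inside S and at most \<open>t * a\<close>
        outside; bracketing t leaves only levels k and k + 1 between.\<close>
      define t where "t = Min ((\<lambda>n. \<bar>?c n / l n\<bar>) ` S)"
      have "t \<in> (\<lambda>n. \<bar>?c n / l n\<bar>) ` S"
        unfolding t_def using False fS by (intro Min_in) auto
      then obtain i where i: "i \<in> S" "t = \<bar>?c i / l i\<bar>" by blast
      have "0 < t" using i False l[of i] by auto
      then obtain k where k: "a powi k < t" "t \<le> a powi (k + 1)"
        using exists_power_int_bracket[OF a] by metis
      have lower: "t \<le> \<bar>?c n\<bar>" if "n \<in> S" for n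
      proof -
        have "t \<le> \<bar>?c n / l n\<bar>" unfolding t_def using that fS by (intro Min_le) auto
        also have "\<dots> \<le> \<bar>?c n\<bar>"
          using conjunct1[OF l, of n] by (simp add: divide_le_eq mult_le_cancel_left1)
        finally show ?thesis .
      qed
      have upper: "\<bar>?c n\<bar> \<le> a powi (k + 2)" if "n \<notin> S" for n
      proof -
        have "\<bar>?c n\<bar> / \<bar>l n\<bar> \<le> t" using S i that by (auto simp: greedy_set_def)
        then have "\<bar>?c n\<bar> \<le> t * \<bar>l n\<bar>" using l[of n] by (simp add: divide_le_eq split: if_splits)
        also have "\<dots> \<le> a powi (k + 1) * a" using k l[of n] a by (intro mult_mono) auto
        also have "\<dots> = a powi (k + 2)"
          using a power_int_add[of a "k + 1" 1] by (simp add: add.assoc)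
        finally show ?thesis .
      qed
      let ?T = "{n. a powi (k + 2) < \<bar>?c n\<bar>}"
      have "?T \<subseteq> S" using upper by fastforce
      moreover have "greedy_set ?c ?T"
        using finite_subset[OF \<open>?T \<subseteq> S\<close> fS] by (auto simp: greedy_set_def)
      moreover have "n \<in> level_set e a k x \<union> level_set e a (k + 1) x" if "n \<in> S - ?T" for n
        using that lower[of n] k by (auto simp: level_set_def add.assoc)
      ultimately show ?thesis by blast
    qed
    then obtain T k where T: "T \<subseteq> S" "greedy_set ?c T" and
      k: "\<And>n. n \<in> S - T \<Longrightarrow> ?c n \<noteq> 0 \<Longrightarrow> n \<in> level_set e a k x \<union> level_set e a (k + 1) x"
      by blast
    let ?A = "level_set e a k x \<union> level_set e a (k + 1) x"
    have fin: "finite (level_set e a j x)" for j by (rule finite_level_set[OF b s x a])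
    have disj: "level_set e a k x \<inter> level_set e a (k + 1) x = {}"
      by (auto simp: level_set_def)
    have "\<bar>sum ?y (S - T)\<bar> \<le> (\<Sum>n\<in>S - T. \<bar>?y n\<bar>)" by (rule sum_abs)
    also have "\<dots> = (\<Sum>n\<in>{n\<in>S - T. ?c n \<noteq> 0}. \<bar>?y n\<bar>)"
      using fS by (intro sum.mono_neutral_right) auto
    also have "\<dots> \<le> (\<Sum>n\<in>?A. \<bar>?y n\<bar>)"
      using k fin by (intro sum_mono2) auto
    also have "\<dots> \<le> w + w"
      using w fin disj by (simp add: sum.union_disjoint add_mono)
    finally have "\<bar>sum ?y (S - T)\<bar> \<le> w + w" .
    from abs_add_le[OF v[OF T(2)] this] show ?thesis
      using sum.subset_diff[OF T(1) fS, of ?y] by (simp add: add.commute)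
  qed
  then show "\<exists>u. \<forall>S. greedy_set (\<lambda>n. ?c n / l n) S \<longrightarrow> \<bar>sum ?y S\<bar> \<le> u" by blast
qed

section \<open>Suprema of level sums\<close>

text \<open>The weight a^j is outweighed by the tail bound (2a)^-j: the j-th segment contributes at
  most 2^-j, a geometric series.\<close>

lemma summable_weighted_segments:
  fixes y :: "nat \<Rightarrow> 'a::banach"
  assumes a: "0 < a" and N: "strict_mono N"
    and tail: "\<And>j p q. N j \<le> p \<Longrightarrow> norm (sum y {p..<q}) \<le> 1 / (2 * a) ^ j"
    and f: "\<And>j n. N j \<le> n \<Longrightarrow> n < N (Suc j) \<Longrightarrow> f n = a ^ j *\<^sub>R y n"
  shows "summable f"
proof -
  have seg: "norm (sum f {p..<q}) \<le> 1 / 2 ^ j" if "N j \<le> p" "q \<le> N (Suc j)" for j p q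
  proof -
    have "sum f {p..<q} = a ^ j *\<^sub>R sum y {p..<q}"
      unfolding scaleR_sum_right using that by (intro sum.cong) (auto intro!: f)
    then have "norm (sum f {p..<q}) = a ^ j * norm (sum y {p..<q})" using a by simp
    also have "\<dots> \<le> a ^ j * (1 / (2 * a) ^ j)" using a tail[OF that(1)] by (intro mult_left_mono) auto
    also have "\<dots> = 1 / 2 ^ j" using a by (simp add: power_mult_distrib)
    finally show ?thesis .
  qed
  \<comment> \<open>The right-hand side is the exact value of the sum of 2^-i over J <= i < J + d,
    which makes the induction on d close.\<close>
  have bound: "norm (sum f {p..<q}) \<le> 2 / 2 ^ J - 2 / 2 ^ (J + d)"
    if "N J \<le> p" "q \<le> N (J + d)" for J d p q
    using that
  proof (induction d arbitrary: q)
    case (Suc d)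
    let ?m = "N (J + d)"
    have step: "2 / 2 ^ (J + Suc d) = 1 / (2 ^ (J + d) :: real)" by simp
    \<comment> \<open>The \<open>min\<close> and \<open>max\<close> also cover intervals lying
      entirely on one side of the cut.\<close>
    have split: "sum f {p..<q} = sum f {p..<min q ?m} + sum f {max p ?m..<q}"
    proof -
      have "{p..<q} = {p..<min q ?m} \<union> {max p ?m..<q}" by auto
      moreover have "{p..<min q ?m} \<inter> {max p ?m..<q} = {}" by auto
      ultimately show ?thesis by (metis finite_atLeastLessThan sum.union_disjoint)
    qed
    have "norm (sum f {p..<q}) \<le> norm (sum f {p..<min q ?m}) + norm (sum f {max p ?m..<q})"
      unfolding split by (rule norm_triangle_ineq)
    also have "\<dots> \<le> (2 / 2 ^ J - 2 / 2 ^ (J + d)) + 1 / 2 ^ (J + d)"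
      using Suc.prems by (intro add_mono Suc.IH seg) auto
    finally show ?case using step by (simp add: field_simps)
  qed simp
  show ?thesis
    unfolding summable_Cauchy
  proof (intro allI impI)
    fix \<epsilon> :: real assume \<epsilon>: "0 < \<epsilon>"
    obtain J where J: "(1 / 2) ^ J < \<epsilon> / 2"
      using real_arch_pow_inv[of "\<epsilon> / 2" "1 / 2"] \<epsilon> by auto
    have "norm (sum f {p..<q}) < \<epsilon>" if "N J \<le> p" for p q
    proof -
      have "q \<le> N (J + q)" using seq_suble[OF N, of "J + q"] by linarith
      from bound[OF that this] have "norm (sum f {p..<q}) \<le> 2 / 2 ^ J - 2 / 2 ^ (J + q)" .
      also have "\<dots> \<le> 2 * (1 / 2) ^ J" by (simp add: power_one_over)
      also have "\<dots> < \<epsilon>" using J by simp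
      finally show ?thesis .
    qed
    then show "\<exists>M. \<forall>m\<ge>M. \<forall>n. norm (sum f {m..<n}) < \<epsilon>" by blast
  qed
qed

definition level_sum ::
    "(nat \<Rightarrow> 'a::banach_lattice) \<Rightarrow> real \<Rightarrow> 'a \<Rightarrow> int \<Rightarrow> 'a" where
  "level_sum e a x k = (\<Sum>n\<in>level_set e a k x. \<bar>basis_coeff e n x *\<^sub>R e n\<bar>)"

lemma level_sum_nonneg: "0 \<le> level_sum e a x k"
  by (simp add: level_sum_def sum_nonneg)

text \<open>Otherwise there are successive segments of the expansion of \<open>x\<close> that carry level sums with
  suprema bounded away from 0. As the expansion converges, these segments can be chosen such that
  multiplying the \<open>j\<close>-th one by \<open>a ^ j\<close> keeps convergence; this shifts its levels by \<open>j\<close> and makes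
  the suprema unbounded.\<close>

lemma level_sums_small_on_tails:
  fixes e :: "nat \<Rightarrow> 'a::banach_lattice"
  assumes E: "subspace E" "closed E" and b: "schauder_basis E e" and s: "semi_normalized e"
    and a: "1 < a"
    and bdd: "\<And>x. x \<in> E \<Longrightarrow> \<exists>C. \<forall>N::nat. norm (Sup_fin (level_sum e a x ` {- int N..int N})) \<le> C"
    and x: "x \<in> E" and \<delta>: "0 < \<delta>"
  shows "\<exists>N. \<forall>I. finite I \<longrightarrow> I \<noteq> {} \<longrightarrow> (\<forall>k\<in>I. level_set e a k x \<subseteq> {N..}) \<longrightarrow>
    norm (Sup_fin (level_sum e a x ` I)) < \<delta>"
proof (rule ccontr)
  assume "\<not> ?thesis"
  then have neg: "\<exists>I. finite I \<and> I \<noteq> {} \<and> (\<forall>k\<in>I. level_set e a k x \<subseteq> {N..}) \<and>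
    \<delta> \<le> norm (Sup_fin (level_sum e a x ` I))" for N
    by (meson not_less)
  define y where "y n = basis_coeff e n x *\<^sub>R e n" for n
  have fin: "finite (level_set e a k x)" for k by (rule finite_level_set[OF b s x a])
  have sy: "summable y"
    using basis_coeff_sums[OF b x] unfolding y_def by (rule sums_summable)
  have tail_ex: "\<exists>M. \<forall>p\<ge>M. \<forall>q. norm (sum y {p..<q}) \<le> 1 / (2 * a) ^ j" for j
  proof -
    have "0 < 1 / (2 * a) ^ j" using a by simp
    then show ?thesis using sy unfolding summable_Cauchy by (meson less_imp_le)
  qed
  define good where "good n m I \<longleftrightarrow> finite I \<and> I \<noteq> {} \<and> (\<forall>k\<in>I. level_set e a k x \<subseteq> {n..<m}) \<and>
    \<delta> \<le> norm (Sup_fin (level_sum e a x ` I))" for n m I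
  have "\<exists>N. \<forall>j. (\<forall>p\<ge>N j. \<forall>q. norm (sum y {p..<q}) \<le> 1 / (2 * a) ^ j) \<and>
      (N j < N (Suc j) \<and> (\<exists>I. good (N j) (N (Suc j)) I))"
  \<comment> \<open>The next cut point must lie beyond all indices used by the current hump I, and
    far enough out for the next tail bound.\<close>
  proof (rule dependent_nat_choice)
    show "\<exists>n. \<forall>p\<ge>n. \<forall>q. norm (sum y {p..<q}) \<le> 1 / (2 * a) ^ 0" by (rule tail_ex)
  next
    fix n j
    obtain I where I: "finite I" "I \<noteq> {}" "\<And>k. k \<in> I \<Longrightarrow> level_set e a k x \<subseteq> {n..}"
      "\<delta> \<le> norm (Sup_fin (level_sum e a x ` I))" using neg[of n] by blast
    have "finite (\<Union>k\<in>I. level_set e a k x)" using I fin by blast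
    from exists_bound_on_finite[OF this, of "\<lambda>i. i"]
    obtain m1 where "\<forall>i\<in>(\<Union>k\<in>I. level_set e a k x). i < m1" by blast
    then have m1: "i < m1" if "k \<in> I" "i \<in> level_set e a k x" for i k
      using that by blast
    obtain m2 where m2: "\<And>p q. m2 \<le> p \<Longrightarrow> norm (sum y {p..<q}) \<le> 1 / (2 * a) ^ Suc j"
      using tail_ex by blast
    define m where "m = max (Suc n) (max m1 m2)"
    have "good n m I" unfolding good_def m_def using I m1 by (fastforce simp: less_max_iff_disj)
    moreover have "n < m" "m2 \<le> m" by (auto simp: m_def)
    ultimately show "\<exists>m. (\<forall>p\<ge>m. \<forall>q. norm (sum y {p..<q}) \<le> 1 / (2 * a) ^ Suc j) \<and>
        (n < m \<and> (\<exists>I. good n m I))"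
      using m2 by (meson order_trans)
  qed
  then obtain N where tail: "\<And>j p q. N j \<le> p \<Longrightarrow> norm (sum y {p..<q}) \<le> 1 / (2 * a) ^ j"
    and Nlt: "\<And>j. N j < N (Suc j)" and exI: "\<And>j. \<exists>I. good (N j) (N (Suc j)) I"
    by blast
  have N: "strict_mono N" using Nlt by (simp add: strict_mono_Suc_iff)
  \<comment> \<open>The number of the segment containing n; indices before \<open>N 0\<close> get 0,
    hence weight 1.\<close>
  define J where "J n = (LEAST j. n < N (Suc j))" for n
  have J: "J n = j" if "N j \<le> n" "n < N (Suc j)" for j n
    unfolding J_def
  proof (rule Least_equality)
    show "n < N (Suc j)" by fact
    fix i assume "n < N (Suc i)"
    then have "N j < N (Suc i)" using that by linarith
    then show "j \<le> i" using strict_mono_less[OF N] by auto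
  qed
  define f where "f n = (a ^ J n * basis_coeff e n x) *\<^sub>R e n" for n
  have "summable f"
    using summable_weighted_segments[OF _ N tail, of f] a by (simp add: f_def y_def J)
  then obtain z where z: "f sums z" by (auto simp: summable_def)
  have "sum f {..<n} \<in> E" for n
    using E(1) b unfolding f_def
    by (intro subspace_sum subspace_scale) (auto simp: schauder_basis_def)
  then have zE: "z \<in> E"
    using z E(2) unfolding sums_def by (metis closed_sequentially)
  have cz: "basis_coeff e n z = a ^ J n * basis_coeff e n x" for n
    using z unfolding f_def by (intro basis_coeff_unique[OF b zE]) auto
  obtain C where C: "\<And>M::nat. norm (Sup_fin (level_sum e a z ` {- int M..int M})) \<le> C"
    using bdd[OF zE] by blast
  have "a ^ j * \<delta> \<le> C" for j
  proof -
    obtain I where I: "finite I" "I \<noteq> {}" "\<And>k. k \<in> I \<Longrightarrow> level_set e a k x \<subseteq> {N j..<N (Suc j)}"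
      "\<delta> \<le> norm (Sup_fin (level_sum e a x ` I))" using exI[of j] by (auto simp: good_def)
    \<comment> \<open>On segment j the factor a^j carries level k of x into level k + j of z and
      enlarges the level sum by a^j.\<close>
    have le: "a ^ j *\<^sub>R level_sum e a x k \<le> level_sum e a z (k + int j)" if k: "k \<in> I" for k
    proof -
      have Jn: "J n = j" if "n \<in> level_set e a k x" for n
        using I(3)[OF k] that J by auto
      have pw: "a powi (i + int j) = a ^ j * a powi i" for i
        using a by (simp add: power_int_add)
      have aj: "0 < a ^ j" using a by simp
      have pw1: "a powi (k + int j + 1) = a ^ j * a powi (k + 1)"
        using pw[of "k + 1"] by (simp add: algebra_simps)
      have sub: "level_set e a k x \<subseteq> level_set e a (k + int j) z"
        using aj Jn by (auto simp: level_set_def cz abs_mult pw pw1)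
      have "a ^ j *\<^sub>R level_sum e a x k = (\<Sum>n\<in>level_set e a k x. a ^ j *\<^sub>R \<bar>y n\<bar>)"
        by (simp add: level_sum_def scaleR_sum_right y_def)
      also have "\<dots> \<le> (\<Sum>n\<in>level_set e a k x. \<bar>basis_coeff e n z *\<^sub>R e n\<bar>)"
      proof (rule sum_mono)
        fix n assume "n \<in> level_set e a k x"
        then have "basis_coeff e n z *\<^sub>R e n = a ^ j *\<^sub>R y n" using Jn by (simp add: cz y_def)
        then show "a ^ j *\<^sub>R \<bar>y n\<bar> \<le> \<bar>basis_coeff e n z *\<^sub>R e n\<bar>"
          using abs_scaleR_pos_ge[OF aj, of "y n"] by simp
      qed
      also have "\<dots> \<le> level_sum e a z (k + int j)"
        unfolding level_sum_def
        using finite_level_set[OF b s zE a] sub by (intro sum_mono2) auto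
      finally show ?thesis .
    qed
    \<comment> \<open>A window large enough to contain all shifted levels, so that the bound C
      applies.\<close>
    obtain M where M: "\<And>k. k \<in> I \<Longrightarrow> nat \<bar>k + int j\<bar> < M"
      using exists_bound_on_finite[OF I(1), of "\<lambda>k. nat \<bar>k + int j\<bar>"] by blast
    let ?U = "Sup_fin (level_sum e a z ` {- int M..int M})"
    have aj: "0 < a ^ j" using a by simp
    have "level_sum e a x k \<le> (1 / a ^ j) *\<^sub>R ?U" if k: "k \<in> I" for k
    proof -
      have "k + int j \<in> {- int M..int M}" using M[OF k] by auto
      then have "level_sum e a z (k + int j) \<le> ?U"
        by (intro Sup_fin.coboundedI) auto
      then have "a ^ j *\<^sub>R level_sum e a x k \<le> ?U" using le[OF k] by (rule order_trans[rotated])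
      from scaleR_left_mono[OF this, of "1 / a ^ j"] show ?thesis using a by simp
    qed
    then have "Sup_fin (level_sum e a x ` I) \<le> (1 / a ^ j) *\<^sub>R ?U"
      using I by (intro Sup_fin.boundedI) auto
    moreover have "0 \<le> Sup_fin (level_sum e a x ` I)"
    proof -
      obtain k where "k \<in> I" using I by blast
      then have "level_sum e a x k \<le> Sup_fin (level_sum e a x ` I)"
        using I by (intro Sup_fin.coboundedI) auto
      then show ?thesis using level_sum_nonneg order_trans by blast
    qed
    ultimately have "norm (Sup_fin (level_sum e a x ` I)) \<le> norm ((1 / a ^ j) *\<^sub>R ?U)"
      by (rule norm_mono_nonneg[rotated])
    with I(4) have "\<delta> \<le> norm ?U / a ^ j" using aj by simp
    then have "a ^ j * \<delta> \<le> norm ?U" using aj by (simp add: field_simps)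
    with C[of M] show ?thesis by linarith
  qed
  moreover obtain j where "C / \<delta> < a ^ j" using real_arch_pow[OF a] by blast
  ultimately show False using \<delta> by (meson not_le pos_divide_less_eq)
qed

text \<open>Since levels are disjoint, those with large |k| avoid any given initial block of
  indices. So the increments of the finite suprema \<open>U\<close> come from tails and are small in
  norm; the limit of \<open>U\<close> is the required bound.\<close>

lemma level_sums_bounded_if_norm_bounded:
  fixes e :: "nat \<Rightarrow> 'a::banach_lattice"
  assumes E: "subspace E" "closed E" and b: "schauder_basis E e" and s: "semi_normalized e"
    and a: "1 < a"
    and bdd: "\<And>x. x \<in> E \<Longrightarrow> \<exists>C. \<forall>N::nat. norm (Sup_fin (level_sum e a x ` {- int N..int N})) \<le> C"
    and x: "x \<in> E"
  shows "\<exists>u. \<forall>k. level_sum e a x k \<le> u"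
proof -
  define U where "U N = Sup_fin (level_sum e a x ` {- int N..int N})" for N :: nat
  have le_U: "level_sum e a x k \<le> U N" if "\<bar>k\<bar> \<le> int N" for k N
    unfolding U_def using that by (intro Sup_fin.coboundedI imageI) auto
  have U_le: "U N \<le> w" if "\<And>k. \<bar>k\<bar> \<le> int N \<Longrightarrow> level_sum e a x k \<le> w" for N w
    unfolding U_def using that by (intro Sup_fin.boundedI) auto
  have U_nonneg: "0 \<le> U N" for N
    using le_U[of 0 N] level_sum_nonneg order_trans by (metis abs_zero of_nat_0_le_iff)
  have U_mono: "U N \<le> U M" if "N \<le> M" for N M
    using that by (intro U_le le_U) auto
  have lvl: "\<exists>K. \<forall>k. int K < \<bar>k\<bar> \<longrightarrow> level_set e a k x \<subseteq> {N..}" for N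
  proof -
    have one: "k = k'" if "n \<in> level_set e a k x" "n \<in> level_set e a k' x" for n k k'
    proof -
      have "a powi k < a powi (k' + 1)" "a powi k' < a powi (k + 1)"
        using that by (auto simp: level_set_def)
      then show ?thesis by (simp add: power_int_less_iff[OF a])
    qed
    \<comment> \<open>The value at an index with coefficient 0 is arbitrary, but such an index lies
      in no level.\<close>
    define \<kappa> where "\<kappa> n = (THE k. n \<in> level_set e a k x)" for n
    have \<kappa>: "\<kappa> n = k" if "n \<in> level_set e a k x" for n k
      unfolding \<kappa>_def using that one by blast
    obtain K where K: "\<And>n. n \<in> {..<N} \<Longrightarrow> nat \<bar>\<kappa> n\<bar> < K"
      using exists_bound_on_finite[of "{..<N}" "\<lambda>n. nat \<bar>\<kappa> n\<bar>"] by blast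
    have "level_set e a k x \<subseteq> {N..}" if "int K < \<bar>k\<bar>" for k
    proof
      fix n assume "n \<in> level_set e a k x"
      then show "n \<in> {N..}" using K[of n] \<kappa>[of n k] that by fastforce
    qed
    then show ?thesis by blast
  qed
  have small: "\<exists>K. \<forall>M\<ge>K. norm (U M - U K) < \<delta>" if \<delta>: "0 < \<delta>" for \<delta>
  proof -
    have "\<exists>N. \<forall>I. finite I \<longrightarrow> I \<noteq> {} \<longrightarrow> (\<forall>k\<in>I. level_set e a k x \<subseteq> {N..}) \<longrightarrow>
        norm (Sup_fin (level_sum e a x ` I)) < \<delta>"
      by (rule level_sums_small_on_tails[OF E b s a bdd x \<delta>])
    then obtain N where N: "\<forall>I. finite I \<longrightarrow> I \<noteq> {} \<longrightarrow> (\<forall>k\<in>I. level_set e a k x \<subseteq> {N..}) \<longrightarrow>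
        norm (Sup_fin (level_sum e a x ` I)) < \<delta>"
      by blast
    obtain K where K: "\<And>k. int K < \<bar>k\<bar> \<Longrightarrow> level_set e a k x \<subseteq> {N..}"
      using lvl by blast
    have "norm (U M - U K) < \<delta>" if M: "K \<le> M" for M
    proof (cases "K = M")
      case False
      define I where "I = {k. int K < \<bar>k\<bar> \<and> \<bar>k\<bar> \<le> int M}"
      have fI: "finite I" by (rule finite_subset[of _ "{- int M..int M}"]) (auto simp: I_def)
      have "int M \<in> I" using M False by (auto simp: I_def)
      then have neI: "I \<noteq> {}" by blast
      let ?V = "Sup_fin (level_sum e a x ` I)"
      have le_V: "level_sum e a x k \<le> ?V" if "k \<in> I" for k
        using fI that by (intro Sup_fin.coboundedI) auto
      have V0: "0 \<le> ?V" using le_V[OF \<open>int M \<in> I\<close>] level_sum_nonneg order_trans by blast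
      \<comment> \<open>Each level sum is below one of the two summands, and both are
        nonnegative.\<close>
      have "U M \<le> U K + ?V"
      proof (rule U_le)
        fix k assume k: "\<bar>k\<bar> \<le> int M"
        show "level_sum e a x k \<le> U K + ?V"
        proof (cases "\<bar>k\<bar> \<le> int K")
          case True
          then show ?thesis using le_U[OF True] V0 by (simp add: add_increasing2)
        next
          case False
          then show ?thesis using le_V[of k] k U_nonneg by (simp add: I_def add_increasing)
        qed
      qed
      then have "norm (U M - U K) \<le> norm ?V"
        using U_mono[OF M] by (intro norm_mono_nonneg) (simp_all add: algebra_simps)
      also have "\<dots> < \<delta>" using N fI neI K by (simp add: I_def)
      finally show ?thesis .
    qed (use \<delta> in simp)
    then show ?thesis by blast
  qed
  have "Cauchy U"
    unfolding Cauchy_altdef2 dist_norm using small by simp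
  then obtain u where u: "U \<longlonglongrightarrow> u" using Cauchy_convergent_iff convergent_def by blast
  have "level_sum e a x k \<le> u" for k
  proof (rule le_of_tendsto_eventually[OF u])
    show "eventually (\<lambda>N. level_sum e a x k \<le> U N) sequentially"
      unfolding eventually_sequentially
      by (intro exI[of _ "nat \<bar>k\<bar>"]) (auto intro: le_U)
  qed
  then show ?thesis by blast
qed

lemma norm_Sup_level_sums_bounded:
  assumes "\<And>k. level_sum e a x k \<le> u"
  shows "norm (Sup_fin (level_sum e a x ` {- int N..int N})) \<le> norm u"
proof (rule norm_mono_nonneg)
  have "level_sum e a x 0 \<le> Sup_fin (level_sum e a x ` {- int N..int N})"
    by (intro Sup_fin.coboundedI) auto
  then show "0 \<le> Sup_fin (level_sum e a x ` {- int N..int N})"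
    using level_sum_nonneg order_trans by blast
  show "Sup_fin (level_sum e a x ` {- int N..int N}) \<le> u"
    using assms by (intro Sup_fin.boundedI) auto
qed

theorem proposition3p16:
  fixes E :: "'a::banach_lattice set" and e :: "nat \<Rightarrow> 'a" and a :: real
  assumes "subspace E" and "closed E"
    and "schauder_basis E e" and "semi_normalized e" and "absolutely_quasi_greedy E e"
    and "1 < a"
  shows
    "((\<forall>l::nat \<Rightarrow> real. (\<forall>n. 1 \<le> \<bar>l n\<bar> \<and> \<bar>l n\<bar> \<le> a) \<longrightarrow>
          absolutely_quasi_greedy E (\<lambda>n. l n *\<^sub>R e n))
      \<longleftrightarrow>
      (\<forall>x\<in>E. \<exists>u::'a. \<forall>k::int.
          (\<Sum>n\<in>level_set e a k x. \<bar>basis_coeff e n x *\<^sub>R e n\<bar>) \<le> u))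
     \<and>
     ((\<forall>x\<in>E. \<exists>u::'a. \<forall>k::int.
          (\<Sum>n\<in>level_set e a k x. \<bar>basis_coeff e n x *\<^sub>R e n\<bar>) \<le> u)
      \<longleftrightarrow>
      (\<forall>x\<in>E. \<exists>C::real. C > 0 \<and> (\<forall>N::nat.
          norm (Sup_fin ((\<lambda>k. \<Sum>n\<in>level_set e a k x. \<bar>basis_coeff e n x *\<^sub>R e n\<bar>)
                          ` {- int N .. int N})) \<le> C)))"
  (is "(?i \<longleftrightarrow> ?ii) \<and> (_ \<longleftrightarrow> ?iii)")
proof (intro conjI iffI)
  show ?ii if ?i
    using level_sums_bounded_if_scaled_absolutely_quasi_greedy[OF assms(1,3,4,6)] that by blast
  show ?i if ?ii
    using scaled_absolutely_quasi_greedy_if_level_sums_bounded[OF assms(1,3,4,6,5)] that by blast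
  show ?iii if ii: ?ii
  proof
    fix x assume "x \<in> E"
    then obtain u where "\<And>k. level_sum e a x k \<le> u"
      using ii unfolding level_sum_def by blast
    \<comment> \<open>Adding 1 makes the constant strictly positive even if u is 0.\<close>
    then have "norm (Sup_fin (level_sum e a x ` {- int N..int N})) \<le> norm u + 1" for N
      using norm_Sup_level_sums_bounded[of e a x u N] by simp
    then show "\<exists>C>0. \<forall>N::nat. norm (Sup_fin ((\<lambda>k. \<Sum>n\<in>level_set e a k x.
        \<bar>basis_coeff e n x *\<^sub>R e n\<bar>) ` {- int N..int N})) \<le> C"
      unfolding level_sum_def by (intro exI[of _ "norm u + 1"]) (simp add: add_nonneg_pos)
  qed
  show ?ii if ?iii
    using level_sums_bounded_if_norm_bounded[OF assms(1-4,6)] that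
    unfolding level_sum_def by blast
qed

end
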